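(* Consider the linear regression setting and the high-dimensional asymptotic assumptions described in the context (candidate models need not contain the whole support of $\beta$), with $\|\beta_{S_i}\|^2=r^2\kappa_i$ and $\|\beta_{S_i\cap S_j}\|^2=r^2\kappa_{ij}$, $\kappa_i,\kappa_{ij}\in(0,1)$, for $i,j=1,\dots,m$, $i\neq j$. Define $\mathrm{SNR}=r^2/\sigma^2$, $\mathrm{SNR}_i=r^2\kappa_i/\sigma^2$, $\mathrm{SNR}_{ij}=r^2\kappa_{ij}/\sigma^2$, and let $\hat\Gamma,\hat\Gamma_i,\hat\Gamma_{ij}$ be consistent estimators of $\mathrm{SNR},\mathrm{SNR}_i,\mathrm{SNR}_{ij}$ respectively. Let $\hat H_{\mathrm{mis}}=(\hat h_{\mathrm{mis},ij})$ be defined by $$\hat h_{\mathrm{mis},ii}=\begin{cases}\dfrac{\eta_i}{\eta_i-\gamma_i}(\hat\Gamma-\hat\Gamma_i)+\dfrac{\gamma_i}{\eta_i-\gamma_i} & \gamma_i<\eta_i,\\[2mm] \dfrac{\gamma_i}{\gamma_i-\eta_i}(\hat\Gamma-\hat\Gamma_i)+\left(1-\dfrac{\eta_i}{\gamma_i}\right)\hat\Gamma_i+\dfrac{\eta_i}{\gamma_i-\eta_i} & \eta_i<\gamma_i,\end{cases}$$ and, for $i\ne j$, writing $\hat A_{ij}=\hat\Gamma-\hat\Gamma_i-\hat\Gamma_j+\hat\Gamma_{ij}$: - if $\gamma_i<\eta_i,\ \gamma_j<\eta_j$: $\ \hat h_{\mathrm{mis},ij}=\dfrac{\eta_i\eta_j}{\eta_i\eta_j-\eta_{ij}\gamma_{ij}}\hat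 A_{ij}+\dfrac{\eta_{ij}\gamma_{ij}}{\eta_i\eta_j-\eta_{ij}\gamma_{ij}}$; - if $\gamma_i<\eta_i,\ \eta_j<\gamma_j$: $\ \hat h_{\mathrm{mis},ij}=\dfrac{\eta_i\gamma_j}{\eta_i\gamma_j-\eta_{ij}\gamma_{ij}}\hat A_{ij}+\dfrac{\eta_i(\gamma_j-\eta_j)}{\eta_i\gamma_j-\eta_{ij}\gamma_{ij}}(\hat\Gamma_j-\hat\Gamma_{ij})+\dfrac{\eta_{ij}\gamma_{ij}}{\eta_i\gamma_j-\eta_{ij}\gamma_{ij}}$; - if $\gamma_j<\eta_j,\ \eta_i<\gamma_i$: $\ \hat h_{\mathrm{mis},ij}=\dfrac{\eta_j\gamma_i}{\eta_j\gamma_i-\eta_{ij}\gamma_{ij}}\hat A_{ij}+\dfrac{\eta_j(\gamma_i-\eta_i)}{\eta_j\gamma_i-\eta_{ij}\gamma_{ij}}(\hat\Gamma_i-\hat\Gamma_{ij})+\dfrac{\eta_{ij}\gamma_{ij}}{\eta_j\gamma_i-\eta_{ij}\gamma_{ij}}$; - if $\eta_i<\gamma_i,\ \eta_j<\gamma_j$: $\ \hat h_{\mathrm{mis},ij}=\dfrac{\gamma_i\gamma_j}{\gamma_i\gamma_j-\eta_{ij}\gamma_{ij}}\hat A_{ij}+\dfrac{\gamma_i(\gamma_j-\eta_j)}{\gamma_i\gamma_j-\eta_{ij}\gamma_{ij}}(\hat\Gamma_j-\hat\Gamma_{ij})+\dfrac{\gamma_j(\gamma_i-\eta_i)}{\gamma_i\gamma_j-\eta_{ij}\gamma_{ij}}(\hat\Gamma_i-\hat\Gamma_{ij})+\dfrac{(\gamma_i-\eta_i)(\gamma_j-\eta_j)}{\gamma_i\gamma_j-\eta_{ij}\gamma_{ij}}\hat\Gamma_{ij}+\dfrac{\eta_{ij}\gamma_{ij}}{\gamma_i\gamma_j-\eta_{ij}\gamma_{ij}}$.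 Then, with $\mathbf 1=(1,\dots,1)^\top\in\mathbb{R}^m$, $$w_{\mathrm{opt}}=\frac{1}{\mathbf 1^\top\hat H_{\mathrm{mis}}^{-1}\mathbf 1}\hat H_{\mathrm{mis}}^{-1}\mathbf 1\ \longrightarrow\ \operatorname*{argmin}_{w\in\mathbb{R}^m:\ \sum_iw_i=1}w^\top H_{\mathrm{mis}}w$$ in probability as $n\to\infty$, where $H_{\mathrm{mis}}$ is the positive definite matrix given in the context.
   Context: **Model.** For each $n$, $y=X\beta+\epsilon\in\mathbb{R}^n$, where $X=X_n\in\mathbb{R}^{n\times p}$ ($p=p_n$) and $\epsilon\in\mathbb{R}^n$ has i.i.d. entries with mean $0$ and variance $\sigma^2>0$, independent of $X$. **High-dimensional asymptotics.** (1) The entries of $X_n$ are i.i.d. with mean $0$, variance $1$ and $\mathbb{E}[|X_{n,ij}|^{12+\omega}]<\infty$ for some $\omega>0$. (2) $n,p\to\infty$ with $p/n\to\gamma>0$. (3) There is a fixed number $m$ of candidate models; model $i$ uses a nonrandom feature index set $S_i\subseteq\{1,\dots,p\}$, with $|S_i|\to\infty$, $|S_i\cap S_j|\to\infty$, $|S_i|/n\to\gamma_i>0$ and $|S_i\cap S_j|/n\to\gamma_{ij}>0$. (4) Model $i$ uses a nonrandom sample index set $T_i\subseteq\{1,\dots,n\}$, with $|T_i|\to\infty$, $|T_i|/n\to\eta_i>0$ and $|T_i\cap T_j|/n\to\eta_{ij}>0$. It is assumed that $\gamma_i\ne\eta_i$ for every $i$. **Coefficients.** $\beta=\beta_n\in\mathbb{R}^p$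 is deterministic with $\|\beta\|^2=r^2$, $r>0$ fixed; $\beta_S$ is the subvector of $\beta$ with indices in $S$. **Consistency.** An estimator is consistent if it converges in probability to its target as $n\to\infty$. **The matrix $H_{\mathrm{mis}}$** $=(h_{\mathrm{mis},ij})$ (positive definite; $w^\top H_{\mathrm{mis}}w$ is the limiting expected out-of-sample risk of the model averaging estimator with limiting weights $w$): $$h_{\mathrm{mis},ii}=\begin{cases}\frac{\eta_i}{\eta_i-\gamma_i}r^2(1-\kappa_i)+\frac{\gamma_i}{\eta_i-\gamma_i}\sigma^2 & \gamma_i<\eta_i,\\ \frac{\gamma_i}{\gamma_i-\eta_i}r^2(1-\kappa_i)+\left(1-\frac{\eta_i}{\gamma_i}\right)r^2\kappa_i+\frac{\eta_i}{\gamma_i-\eta_i}\sigma^2 & \eta_i<\gamma_i,\end{cases}$$ and for $i\ne j$, with $a_{ij}=1-\kappa_i-\kappa_j+\kappa_{ij}$: if $\gamma_i<\eta_i,\gamma_j<\eta_j$, $h_{\mathrm{mis},ij}=\frac{\eta_i\eta_j}{\eta_i\eta_j-\eta_{ij}\gamma_{ij}}r^2a_{ij}+\frac{\eta_{ij}\gamma_{ij}}{\eta_i\eta_j-\eta_{ij}\gamma_{ij}}\sigma^2$; if $\gamma_i<\eta_i,\eta_j<\gamma_j$, $h_{\mathrm{mis},ij}=\frac{\eta_i\gamma_j}{\eta_i\gamma_j-\eta_{ij}\gamma_{ij}}r^2a_{ij}+\frac{\eta_i(\gamma_j-\eta_j)}{\eta_i\gamma_j-\eta_{ij}\gamma_{ij}}r^2(\kappa_j-\kappa_{ij})+\frac{\eta_{ij}\gamma_{ij}}{\eta_i\gamma_j-\eta_{ij}\gamma_{ij}}\sigma^2$;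 if $\gamma_j<\eta_j,\eta_i<\gamma_i$, $h_{\mathrm{mis},ij}=\frac{\eta_j\gamma_i}{\eta_j\gamma_i-\eta_{ij}\gamma_{ij}}r^2a_{ij}+\frac{\eta_j(\gamma_i-\eta_i)}{\eta_j\gamma_i-\eta_{ij}\gamma_{ij}}r^2(\kappa_i-\kappa_{ij})+\frac{\eta_{ij}\gamma_{ij}}{\eta_j\gamma_i-\eta_{ij}\gamma_{ij}}\sigma^2$; if $\eta_i<\gamma_i,\eta_j<\gamma_j$, $h_{\mathrm{mis},ij}=\frac{\gamma_i\gamma_j}{\gamma_i\gamma_j-\eta_{ij}\gamma_{ij}}r^2a_{ij}+\frac{\gamma_i(\gamma_j-\eta_j)}{\gamma_i\gamma_j-\eta_{ij}\gamma_{ij}}r^2(\kappa_j-\kappa_{ij})+\frac{\gamma_j(\gamma_i-\eta_i)}{\gamma_i\gamma_j-\eta_{ij}\gamma_{ij}}r^2(\kappa_i-\kappa_{ij})+\frac{(\gamma_i-\eta_i)(\gamma_j-\eta_j)}{\gamma_i\gamma_j-\eta_{ij}\gamma_{ij}}r^2\kappa_{ij}+\frac{\eta_{ij}\gamma_{ij}}{\gamma_i\gamma_j-\eta_{ij}\gamma_{ij}}\sigma^2$. *)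

theory Defs
  imports "HOL-Probability.Probability"
begin

text \<open>
  Convergence in probability to a constant. Every sample size may have its own probability space.
  Measurability is part of the definition, since \<^const>\<open>measure\<close> is 0 on non-measurable sets.
\<close>
definition tendsto_in_prob ::
    "(nat \<Rightarrow> 'a measure) \<Rightarrow> (nat \<Rightarrow> 'a \<Rightarrow> 'b::metric_space) \<Rightarrow> 'b \<Rightarrow> bool" where
  "tendsto_in_prob M Z l \<longleftrightarrow>
     (\<forall>n. Z n \<in> borel_measurable (M n)) \<and>
     (\<forall>e>0. (\<lambda>n. measure (M n) {\<omega> \<in> space (M n). dist (Z n \<omega>) l > e}) \<longlonglongrightarrow> 0)"

definition iid_on :: "'a measure \<Rightarrow> 'i set \<Rightarrow> ('i \<Rightarrow> 'a \<Rightarrow> real) \<Rightarrow> bool" where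
  "iid_on M I Z \<longleftrightarrow>
     prob_space.indep_vars M (\<lambda>_. borel) Z I \<and>
     (\<forall>i\<in>I. \<forall>j\<in>I. distr M borel (Z i) = distr M borel (Z j))"

definition has_mean_var :: "'a measure \<Rightarrow> ('a \<Rightarrow> real) \<Rightarrow> real \<Rightarrow> real \<Rightarrow> bool" where
  "has_mean_var M Z \<mu> v \<longleftrightarrow>
     integrable M Z \<and> integral\<^sup>L M Z = \<mu> \<and>
     integrable M (\<lambda>\<omega>. (Z \<omega> - \<mu>)\<^sup>2) \<and> integral\<^sup>L M (\<lambda>\<omega>. (Z \<omega> - \<mu>)\<^sup>2) = v"

text \<open>
  Because the dimensions vary with the sample size, an \<open>n \<times> p\<close> matrix and an \<open>n\<close>-vector are
  functions on the index sets \<open>{..<n} \<times> {..<p}\<close> and \<open>{..<n}\<close> (indices start at 0).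
\<close>
definition design_space :: "nat \<Rightarrow> nat \<Rightarrow> (nat \<times> nat \<Rightarrow> real) measure" where
  "design_space n p = (\<Pi>\<^sub>M _ \<in> {..<n} \<times> {..<p}. borel)"

definition sample_space :: "nat \<Rightarrow> (nat \<Rightarrow> real) measure" where
  "sample_space n = (\<Pi>\<^sub>M _ \<in> {..<n}. borel)"

definition design_of :: "nat \<Rightarrow> nat \<Rightarrow> (nat \<Rightarrow> nat \<Rightarrow> 'a \<Rightarrow> real) \<Rightarrow> 'a \<Rightarrow> nat \<times> nat \<Rightarrow> real" where
  "design_of n p X \<omega> = (\<lambda>(i, j) \<in> {..<n} \<times> {..<p}. X i j \<omega>)"

definition vector_of :: "nat \<Rightarrow> (nat \<Rightarrow> 'a \<Rightarrow> real) \<Rightarrow> 'a \<Rightarrow> nat \<Rightarrow> real" where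
  "vector_of n \<epsilon> \<omega> = (\<lambda>i \<in> {..<n}. \<epsilon> i \<omega>)"

text \<open>
  Independence of two random elements. The library's \<open>indep_var\<close> requires both to take values in the
  same type, so independence of the generated sigma algebras is stated directly.
\<close>
definition indep_elements ::
    "'a measure \<Rightarrow> 'b measure \<Rightarrow> ('a \<Rightarrow> 'b) \<Rightarrow> 'c measure \<Rightarrow> ('a \<Rightarrow> 'c) \<Rightarrow> bool" where
  "indep_elements M N U N' V \<longleftrightarrow>
     U \<in> M \<rightarrow>\<^sub>M N \<and> V \<in> M \<rightarrow>\<^sub>M N' \<and>
     prob_space.indep_set M (sets (vimage_algebra (space M) U N)) (sets (vimage_algebra (space M) V N'))"

text \<open>The linear model \<open>y = X \<beta> + \<epsilon>\<close> at a single sample size \<open>n\<close> with \<open>p\<close> features.\<close>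
definition linear_model ::
    "'a measure \<Rightarrow> nat \<Rightarrow> nat \<Rightarrow> (nat \<Rightarrow> nat \<Rightarrow> 'a \<Rightarrow> real) \<Rightarrow> (nat \<Rightarrow> real) \<Rightarrow>
     (nat \<Rightarrow> 'a \<Rightarrow> real) \<Rightarrow> (nat \<Rightarrow> 'a \<Rightarrow> real) \<Rightarrow> real \<Rightarrow> bool" where
  "linear_model M n p X \<beta> \<epsilon> y \<sigma> \<longleftrightarrow>
     prob_space M \<and>
     (\<forall>i<n. \<forall>j<p. X i j \<in> borel_measurable M) \<and>
     iid_on M {..<n} \<epsilon> \<and>
     (\<forall>i<n. has_mean_var M (\<epsilon> i) 0 (\<sigma>\<^sup>2)) \<and>
     indep_elements M (design_space n p) (design_of n p X) (sample_space n) (vector_of n \<epsilon>) \<and>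
     (\<forall>i<n. \<forall>\<omega>\<in>space M. y i \<omega> = (\<Sum>j<p. X i j \<omega> * \<beta> j) + \<epsilon> i \<omega>)"

definition sqnorm_on :: "nat set \<Rightarrow> (nat \<Rightarrow> real) \<Rightarrow> real" where
  "sqnorm_on S \<beta> = (\<Sum>j\<in>S. (\<beta> j)\<^sup>2)"

text \<open>An estimator is, for each \<open>n\<close>, a measurable function \<open>G n\<close> of the data \<open>(X, y)\<close>.\<close>
definition estimate ::
    "(nat \<Rightarrow> nat) \<Rightarrow> (nat \<Rightarrow> nat \<Rightarrow> nat \<Rightarrow> 'a \<Rightarrow> real) \<Rightarrow> (nat \<Rightarrow> nat \<Rightarrow> 'a \<Rightarrow> real) \<Rightarrow>
     (nat \<Rightarrow> (nat \<times> nat \<Rightarrow> real) \<times> (nat \<Rightarrow> real) \<Rightarrow> real) \<Rightarrow> nat \<Rightarrow> 'a \<Rightarrow> real" where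
  "estimate p X y G n \<omega> = G n (design_of n (p n) (X n) \<omega>, vector_of n (y n) \<omega>)"

definition consistent_estimator ::
    "(nat \<Rightarrow> 'a measure) \<Rightarrow> (nat \<Rightarrow> nat) \<Rightarrow> (nat \<Rightarrow> nat \<Rightarrow> nat \<Rightarrow> 'a \<Rightarrow> real) \<Rightarrow>
     (nat \<Rightarrow> nat \<Rightarrow> 'a \<Rightarrow> real) \<Rightarrow>
     (nat \<Rightarrow> (nat \<times> nat \<Rightarrow> real) \<times> (nat \<Rightarrow> real) \<Rightarrow> real) \<Rightarrow> real \<Rightarrow> bool" where
  "consistent_estimator M p X y G \<theta> \<longleftrightarrow>
     (\<forall>n. G n \<in> borel_measurable (design_space n (p n) \<Otimes>\<^sub>M sample_space n)) \<and>
     tendsto_in_prob M (estimate p X y G) \<theta>"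

definition positive_definite :: "real^'m^'m \<Rightarrow> bool" where
  "positive_definite A \<longleftrightarrow> transpose A = A \<and> (\<forall>x. x \<noteq> 0 \<longrightarrow> x \<bullet> (A *v x) > 0)"

text \<open>
  Arguments: the signal strength \<open>r\<^sup>2\<close> and noise variance \<open>\<sigma>\<^sup>2\<close> (through \<open>r\<close>, \<open>\<sigma>\<close>); \<open>\<kappa> i\<close>,
  \<open>\<eta> i\<close>, \<open>\<gamma> i\<close>, and the pairwise \<open>\<kappa>2 i j\<close>, \<open>\<eta>2 i j\<close>, \<open>\<gamma>2 i j\<close>, which are only used for
  \<open>i \<noteq> j\<close>. Since \<open>\<gamma> i \<noteq> \<eta> i\<close> is assumed, the final \<open>else\<close> is \<open>\<eta> i < \<gamma> i\<close> (and \<open>\<eta> j < \<gamma> j\<close>).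
\<close>
definition H_mis ::
    "real \<Rightarrow> real \<Rightarrow> ('m \<Rightarrow> real) \<Rightarrow> ('m \<Rightarrow> 'm \<Rightarrow> real) \<Rightarrow> ('m \<Rightarrow> real) \<Rightarrow> ('m \<Rightarrow> 'm \<Rightarrow> real) \<Rightarrow>
     ('m \<Rightarrow> real) \<Rightarrow> ('m \<Rightarrow> 'm \<Rightarrow> real) \<Rightarrow> real^'m^'m" where
  "H_mis r \<sigma> \<kappa> \<kappa>2 \<eta> \<eta>2 \<gamma> \<gamma>2 = (\<chi> i j.
     let a = 1 - \<kappa> i - \<kappa> j + \<kappa>2 i j; q = \<eta>2 i j * \<gamma>2 i j in
     if i = j then
       (if \<gamma> i < \<eta> i then
          \<eta> i / (\<eta> i - \<gamma> i) * r\<^sup>2 * (1 - \<kappa> i) + \<gamma> i / (\<eta> i - \<gamma> i) * \<sigma>\<^sup>2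
        else
          \<gamma> i / (\<gamma> i - \<eta> i) * r\<^sup>2 * (1 - \<kappa> i) + (1 - \<eta> i / \<gamma> i) * r\<^sup>2 * \<kappa> i
          + \<eta> i / (\<gamma> i - \<eta> i) * \<sigma>\<^sup>2)
     else if \<gamma> i < \<eta> i \<and> \<gamma> j < \<eta> j then
       \<eta> i * \<eta> j / (\<eta> i * \<eta> j - q) * r\<^sup>2 * a + q / (\<eta> i * \<eta> j - q) * \<sigma>\<^sup>2
     else if \<gamma> i < \<eta> i \<and> \<eta> j < \<gamma> j then
       \<eta> i * \<gamma> j / (\<eta> i * \<gamma> j - q) * r\<^sup>2 * a
       + \<eta> i * (\<gamma> j - \<eta> j) / (\<eta> i * \<gamma> j - q) * r\<^sup>2 * (\<kappa> j - \<kappa>2 i j)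
       + q / (\<eta> i * \<gamma> j - q) * \<sigma>\<^sup>2
     else if \<gamma> j < \<eta> j \<and> \<eta> i < \<gamma> i then
       \<eta> j * \<gamma> i / (\<eta> j * \<gamma> i - q) * r\<^sup>2 * a
       + \<eta> j * (\<gamma> i - \<eta> i) / (\<eta> j * \<gamma> i - q) * r\<^sup>2 * (\<kappa> i - \<kappa>2 i j)
       + q / (\<eta> j * \<gamma> i - q) * \<sigma>\<^sup>2
     else
       \<gamma> i * \<gamma> j / (\<gamma> i * \<gamma> j - q) * r\<^sup>2 * a
       + \<gamma> i * (\<gamma> j - \<eta> j) / (\<gamma> i * \<gamma> j - q) * r\<^sup>2 * (\<kappa> j - \<kappa>2 i j)
       + \<gamma> j * (\<gamma> i - \<eta> i) / (\<gamma> i * \<gamma> j - q) * r\<^sup>2 * (\<kappa> i - \<kappa>2 i j)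
       + (\<gamma> i - \<eta> i) * (\<gamma> j - \<eta> j) / (\<gamma> i * \<gamma> j - q) * r\<^sup>2 * \<kappa>2 i j
       + q / (\<gamma> i * \<gamma> j - q) * \<sigma>\<^sup>2)"

text \<open>\<open>\<Gamma>\<close>, \<open>\<Gamma>1 i\<close>, \<open>\<Gamma>2 i j\<close> are the estimates of the overall, per-model and pairwise SNR.\<close>
definition H_mis_hat ::
    "real \<Rightarrow> ('m \<Rightarrow> real) \<Rightarrow> ('m \<Rightarrow> 'm \<Rightarrow> real) \<Rightarrow> ('m \<Rightarrow> real) \<Rightarrow> ('m \<Rightarrow> 'm \<Rightarrow> real) \<Rightarrow>
     ('m \<Rightarrow> real) \<Rightarrow> ('m \<Rightarrow> 'm \<Rightarrow> real) \<Rightarrow> real^'m^'m" where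
  "H_mis_hat \<Gamma> \<Gamma>1 \<Gamma>2 \<eta> \<eta>2 \<gamma> \<gamma>2 = (\<chi> i j.
     let A = \<Gamma> - \<Gamma>1 i - \<Gamma>1 j + \<Gamma>2 i j; q = \<eta>2 i j * \<gamma>2 i j in
     if i = j then
       (if \<gamma> i < \<eta> i then
          \<eta> i / (\<eta> i - \<gamma> i) * (\<Gamma> - \<Gamma>1 i) + \<gamma> i / (\<eta> i - \<gamma> i)
        else
          \<gamma> i / (\<gamma> i - \<eta> i) * (\<Gamma> - \<Gamma>1 i) + (1 - \<eta> i / \<gamma> i) * \<Gamma>1 i + \<eta> i / (\<gamma> i - \<eta> i))
     else if \<gamma> i < \<eta> i \<and> \<gamma> j < \<eta> j then
       \<eta> i * \<eta> j / (\<eta> i * \<eta> j - q) * A + q / (\<eta> i * \<eta> j - q)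
     else if \<gamma> i < \<eta> i \<and> \<eta> j < \<gamma> j then
       \<eta> i * \<gamma> j / (\<eta> i * \<gamma> j - q) * A
       + \<eta> i * (\<gamma> j - \<eta> j) / (\<eta> i * \<gamma> j - q) * (\<Gamma>1 j - \<Gamma>2 i j)
       + q / (\<eta> i * \<gamma> j - q)
     else if \<gamma> j < \<eta> j \<and> \<eta> i < \<gamma> i then
       \<eta> j * \<gamma> i / (\<eta> j * \<gamma> i - q) * A
       + \<eta> j * (\<gamma> i - \<eta> i) / (\<eta> j * \<gamma> i - q) * (\<Gamma>1 i - \<Gamma>2 i j)
       + q / (\<eta> j * \<gamma> i - q)
     else
       \<gamma> i * \<gamma> j / (\<gamma> i * \<gamma> j - q) * A
       + \<gamma> i * (\<gamma> j - \<eta> j) / (\<gamma> i * \<gamma> j - q) * (\<Gamma>1 j - \<Gamma>2 i j)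
       + \<gamma> j * (\<gamma> i - \<eta> i) / (\<gamma> i * \<gamma> j - q) * (\<Gamma>1 i - \<Gamma>2 i j)
       + (\<gamma> i - \<eta> i) * (\<gamma> j - \<eta> j) / (\<gamma> i * \<gamma> j - q) * \<Gamma>2 i j
       + q / (\<gamma> i * \<gamma> j - q))"

text \<open>
  The library's \<^const>\<open>matrix_inv\<close> takes one fixed unspecified value on all singular matrices, and
  division by 0 gives 0, so the weights are defined everywhere.
\<close>
definition opt_weights :: "real^'m^'m \<Rightarrow> real^'m" where
  "opt_weights H = (1 / (1 \<bullet> (matrix_inv H *v 1))) *\<^sub>R (matrix_inv H *v 1)"

definition argmin_weights :: "real^'m^'m \<Rightarrow> (real^'m) set" where
  "argmin_weights H =
     {w. is_arg_min (\<lambda>w. w \<bullet> (H *v w)) (\<lambda>w. (\<Sum>i\<in>UNIV. w $ i) = 1) w}"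

end

theory Submission
  imports Defs
begin

text \<open>
  The limit statement is a plug-in argument. Dividing \<^const>\<open>H_mis\<close> by \<open>\<sigma>\<^sup>2\<close> turns \<open>r\<^sup>2\<close>, \<open>r\<^sup>2 \<kappa>\<^sub>i\<close> and
  \<open>r\<^sup>2 \<kappa>\<^sub>i\<^sub>j\<close> into the signal-to-noise ratios and \<open>\<sigma>\<^sup>2\<close> into 1, so \<^const>\<open>H_mis_hat\<close> evaluated at the true
  ratios is a positive multiple of \<^const>\<open>H_mis\<close> (lemma \<open>H_mis_hat_at_SNR\<close>). A positive multiple of a
  quadratic form has the same minimizers, so the target is the minimizer belonging to
  \<^const>\<open>H_mis_hat\<close> at the true ratios.

  For a positive definite \<open>H\<close> the minimizer on the hyperplane \<open>\<Sum>\<^sub>i w\<^sub>i = 1\<close> is unique and equals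
  \<^term>\<open>opt_weights H\<close>: at this \<open>w\<close>, \<open>H w\<close> is a multiple of the all-ones vector, hence orthogonal to every
  admissible direction, and completing the square shows that moving away strictly increases the risk
  (lemma \<open>argmin_weights_pos_def\<close>).

  It remains to transfer the consistency of the estimators through \<open>H \<mapsto> opt_weights H\<close>. By Cramer's rule
  this map agrees on invertible matrices with a quotient of polynomials in the entries
  (lemma \<open>opt_weights_cramer\<close>), and it is constant on singular ones. So it is Borel on all matrices and
  continuous at positive definite ones, which is what the continuous mapping theorem for convergence in
  probability (lemma \<open>tendsto_in_prob_isCont\<close>) asks for.
\<close>

section \<open>Convergence in probability\<close>

lemma borel_measurable_vec:
  fixes f :: "'a \<Rightarrow> real^'k::finite"
  assumes "\<And>k. (\<lambda>x. f x $ k) \<in> borel_measurable M"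
  shows "f \<in> borel_measurable M"
  using assms by (subst borel_measurable_euclidean_space) (auto simp: Basis_vec_def inner_axis)

text \<open>
  If the vector is more than \<open>e\<close> away from its limit, then one of its finitely many entries is more than
  \<open>e / CARD('k)\<close> away, so a union bound suffices.
\<close>
lemma tendsto_in_prob_vec:
  fixes Z :: "nat \<Rightarrow> 'a \<Rightarrow> real^'k::finite"
  assumes M: "\<And>n. finite_measure (M n)"
    and Z: "\<And>k. tendsto_in_prob M (\<lambda>n \<omega>. Z n \<omega> $ k) (l $ k)"
  shows "tendsto_in_prob M Z l"
  unfolding tendsto_in_prob_def
proof (intro conjI allI impI)
  have meas: "(\<lambda>\<omega>. Z n \<omega> $ k) \<in> borel_measurable (M n)" for n k
    using Z unfolding tendsto_in_prob_def by blast
  show "Z n \<in> borel_measurable (M n)" for n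
    by (rule borel_measurable_vec) (rule meas)
  fix e :: real assume "e > 0"
  define d where "d = e / CARD('k)"
  have "d > 0" using \<open>e > 0\<close> by (simp add: d_def)
  define B where "B n k = {\<omega> \<in> space (M n). dist (Z n \<omega> $ k) (l $ k) > d}" for n k
  have B_sets: "B n k \<in> sets (M n)" for n k
    unfolding B_def using meas[of n k] by measurable
  have far: "{\<omega> \<in> space (M n). dist (Z n \<omega>) l > e} \<subseteq> (\<Union>k. B n k)" for n
  proof
    fix \<omega> assume \<omega>: "\<omega> \<in> {\<omega> \<in> space (M n). dist (Z n \<omega>) l > e}"
    have "\<exists>k. dist (Z n \<omega> $ k) (l $ k) > d"
    proof (rule ccontr)
      assume *: "\<not> ?thesis"
      have "dist (Z n \<omega>) l \<le> (\<Sum>k\<in>UNIV. dist (Z n \<omega> $ k) (l $ k))"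
        unfolding dist_vec_def by (rule L2_set_le_sum) simp
      also have "\<dots> \<le> (\<Sum>k\<in>(UNIV::'k set). d)"
        using * by (intro sum_mono) (auto simp: not_less)
      also have "\<dots> = e" by (simp add: d_def)
      finally show False using \<omega> by simp
    qed
    then show "\<omega> \<in> (\<Union>k. B n k)" using \<omega> by (auto simp: B_def)
  qed
  have bound: "measure (M n) {\<omega> \<in> space (M n). dist (Z n \<omega>) l > e} \<le> (\<Sum>k\<in>UNIV. measure (M n) (B n k))"
    for n
  proof -
    interpret finite_measure "M n" by (rule M)
    have "measure (M n) {\<omega> \<in> space (M n). dist (Z n \<omega>) l > e} \<le> measure (M n) (\<Union>k. B n k)"
      by (rule finite_measure_mono[OF far]) (use B_sets in blast)
    also have "\<dots> \<le> (\<Sum>k\<in>UNIV. measure (M n) (B n k))"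
      by (rule finite_measure_subadditive_finite) (use B_sets in auto)
    finally show ?thesis .
  qed
  have "(\<lambda>n. measure (M n) (B n k)) \<longlonglongrightarrow> 0" for k
    using Z[of k] \<open>d > 0\<close> unfolding tendsto_in_prob_def B_def by blast
  then have lim: "(\<lambda>n. \<Sum>k\<in>UNIV. measure (M n) (B n k)) \<longlonglongrightarrow> 0"
    by (intro tendsto_null_sum)
  show "(\<lambda>n. measure (M n) {\<omega> \<in> space (M n). dist (Z n \<omega>) l > e}) \<longlonglongrightarrow> 0"
    by (rule tendsto_sandwich[OF _ _ tendsto_const lim]) (intro always_eventually allI measure_nonneg bound)+
qed

lemma tendsto_in_prob_const:
  "tendsto_in_prob M (\<lambda>n \<omega>. c) c"
  by (simp add: tendsto_in_prob_def)

text \<open>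
  The continuous mapping theorem for a constant limit: if \<open>f\<close> maps points close to \<open>l\<close> to points close
  to \<open>f l\<close>, then \<open>f (Z n)\<close> is far from \<open>f l\<close> only where \<open>Z n\<close> is far from \<open>l\<close>.
\<close>
lemma tendsto_in_prob_isCont:
  fixes Z :: "nat \<Rightarrow> 'a \<Rightarrow> 'b::{metric_space, second_countable_topology}"
    and f :: "'b \<Rightarrow> 'c::metric_space"
  assumes M: "\<And>n. finite_measure (M n)"
    and Z: "tendsto_in_prob M Z l"
    and f: "f \<in> borel_measurable borel" "isCont f l"
  shows "tendsto_in_prob M (\<lambda>n \<omega>. f (Z n \<omega>)) (f l)"
  unfolding tendsto_in_prob_def
proof (intro conjI allI impI)
  have meas: "Z n \<in> borel_measurable (M n)" for n
    using Z unfolding tendsto_in_prob_def by blast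
  show "(\<lambda>\<omega>. f (Z n \<omega>)) \<in> borel_measurable (M n)" for n
    using meas f(1) by (rule measurable_compose)
  fix e :: real assume "e > 0"
  then obtain d where "d > 0" and d: "\<And>x. dist x l < d \<Longrightarrow> dist (f x) (f l) < e"
    using f(2) unfolding continuous_at_eps_delta by blast
  \<comment> \<open>\<open>d / 2\<close> instead of \<open>d\<close>, because the event in the definition excludes equality.\<close>
  have bound: "measure (M n) {\<omega> \<in> space (M n). dist (f (Z n \<omega>)) (f l) > e}
      \<le> measure (M n) {\<omega> \<in> space (M n). dist (Z n \<omega>) l > d / 2}" for n
  proof -
    interpret finite_measure "M n" by (rule M)
    show ?thesis
    proof (rule finite_measure_mono)
      show "{\<omega> \<in> space (M n). dist (f (Z n \<omega>)) (f l) > e}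
          \<subseteq> {\<omega> \<in> space (M n). dist (Z n \<omega>) l > d / 2}"
      proof safe
        fix \<omega> assume "dist (f (Z n \<omega>)) (f l) > e"
        then have "\<not> dist (Z n \<omega>) l < d" using d[of "Z n \<omega>"] by linarith
        then show "dist (Z n \<omega>) l > d / 2" using \<open>d > 0\<close> by linarith
      qed
      show "{\<omega> \<in> space (M n). dist (Z n \<omega>) l > d / 2} \<in> sets (M n)"
        using meas[of n] by measurable
    qed
  qed
  have lim: "(\<lambda>n. measure (M n) {\<omega> \<in> space (M n). dist (Z n \<omega>) l > d / 2}) \<longlonglongrightarrow> 0"
    using Z half_gt_zero[OF \<open>d > 0\<close>] unfolding tendsto_in_prob_def by blast
  show "(\<lambda>n. measure (M n) {\<omega> \<in> space (M n). dist (f (Z n \<omega>)) (f l) > e}) \<longlonglongrightarrow> 0"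
    by (rule tendsto_sandwich[OF _ _ tendsto_const lim]) (intro always_eventually allI measure_nonneg bound)+
qed

section \<open>Minimizing a positive definite form under the sum constraint\<close>

lemma positive_definite_imp_det_nonzero:
  assumes "positive_definite A"
  shows "det A \<noteq> 0"
proof -
  have "\<forall>x. A *v x = 0 \<longrightarrow> x = 0"
    using assms unfolding positive_definite_def by (metis inner_zero_right less_irrefl)
  then show ?thesis
    by (metis matrix_left_invertible_ker invertible_left_inverse invertible_det_nz)
qed

lemma matrix_inv_mult_vector:
  fixes A :: "real^'m^'m"
  assumes "det A \<noteq> 0"
  shows "A *v (matrix_inv A *v b) = b"
proof -
  have "A ** matrix_inv A = mat 1 \<and> matrix_inv A ** A = mat 1"
    unfolding matrix_inv_def
    by (rule someI_ex) (use assms in \<open>simp add: invertible_det_nz[symmetric] invertible_def\<close>)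
  then show ?thesis by (simp add: matrix_vector_mul_assoc)
qed

lemma inner_one_eq_sum: "1 \<bullet> w = (\<Sum>i\<in>UNIV. w $ i)" for w :: "real^'m"
  by (simp add: inner_vec_def)

text \<open>The form \<open>x \<bullet> A x\<close> is positive at \<open>x = A\<^sup>-\<^sup>1 1\<close>, where it equals \<open>1 \<bullet> A\<^sup>-\<^sup>1 1\<close>.\<close>
lemma positive_definite_imp_total_weight_pos:
  assumes "positive_definite A"
  shows "1 \<bullet> (matrix_inv A *v 1) > 0"
proof -
  let ?v = "matrix_inv A *v 1"
  have Av: "A *v ?v = 1"
    using assms by (intro matrix_inv_mult_vector positive_definite_imp_det_nonzero)
  then have "?v \<noteq> 0" by (metis matrix_vector_mult_0_right zero_neq_one)
  then have "?v \<bullet> (A *v ?v) > 0"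
    using assms unfolding positive_definite_def by blast
  then show ?thesis by (simp only: Av) (simp add: inner_commute)
qed

lemma argmin_weights_pos_def:
  assumes A: "positive_definite A"
  shows "argmin_weights A = {opt_weights A}"
proof -
  define c where "c = 1 \<bullet> (matrix_inv A *v 1)"
  define u where "u = opt_weights A"
  have c: "c > 0" unfolding c_def using A by (rule positive_definite_imp_total_weight_pos)
  have u_sum: "1 \<bullet> u = 1" using c by (simp add: u_def opt_weights_def c_def)
  have Au: "A *v u = (1 / c) *\<^sub>R 1"
    unfolding u_def opt_weights_def c_def matrix_vector_mult_scaleR
    by (simp add: matrix_inv_mult_vector positive_definite_imp_det_nonzero[OF A])
  have sym: "x \<bullet> (A *v y) = y \<bullet> (A *v x)" for x y
    using A unfolding positive_definite_def
    by (metis dot_lmul_matrix inner_commute transpose_matrix_vector)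
  \<comment> \<open>The cross term \<open>2 (w - u) \<bullet> A u\<close> vanishes, since \<open>A u\<close> is constant and \<open>w - u\<close> has sum 0.\<close>
  have split: "w \<bullet> (A *v w) = u \<bullet> (A *v u) + (w - u) \<bullet> (A *v (w - u))" if "1 \<bullet> w = 1" for w
  proof -
    have cross: "(w - u) \<bullet> (A *v u) = 0"
      using that u_sum unfolding Au by (simp add: inner_commute[of _ 1] inner_diff_right)
    have "w \<bullet> (A *v w) = (u + (w - u)) \<bullet> (A *v (u + (w - u)))" by simp
    also have "\<dots> = u \<bullet> (A *v u) + u \<bullet> (A *v (w - u)) + (w - u) \<bullet> (A *v u) + (w - u) \<bullet> (A *v (w - u))"
      unfolding matrix_vector_right_distrib inner_add_left inner_add_right by simp
    also have "\<dots> = u \<bullet> (A *v u) + (w - u) \<bullet> (A *v (w - u))"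
      using cross sym[of u "w - u"] by simp
    finally show ?thesis .
  qed
  have strict: "u \<bullet> (A *v u) < w \<bullet> (A *v w)" if "1 \<bullet> w = 1" "w \<noteq> u" for w
    using split[OF that(1)] A that(2) unfolding positive_definite_def by simp
  show ?thesis
    unfolding argmin_weights_def is_arg_min_def inner_one_eq_sum[symmetric] u_def[symmetric]
    using strict u_sum by (auto, metis less_asym less_irrefl)
qed

lemma positive_definite_scaleR:
  assumes "c > 0" "positive_definite A"
  shows "positive_definite (c *\<^sub>R A)"
  using assms unfolding positive_definite_def
  by (simp add: transpose_scalar scaleR_matrix_vector_assoc[symmetric])

lemma argmin_weights_scaleR:
  assumes "c > 0"
  shows "argmin_weights (c *\<^sub>R A) = argmin_weights A"
  using assms unfolding argmin_weights_def is_arg_min_def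
  by (simp add: scaleR_matrix_vector_assoc[symmetric])

section \<open>Regularity of the weight map\<close>

text \<open>
  The numerators of Cramer's rule for \<open>A v = 1\<close>. These are polynomials in the entries of \<open>A\<close>, hence
  continuous also at singular matrices.
\<close>
definition cramer_num :: "real^'m^'m \<Rightarrow> real^'m" where
  "cramer_num A = (\<chi> k. det (\<chi> i j. if j = k then 1 else A $ i $ j))"

lemma continuous_on_det [continuous_intros]:
  fixes f :: "'a::topological_space \<Rightarrow> real^'m^'m"
  assumes "continuous_on S f"
  shows "continuous_on S (\<lambda>x. det (f x))"
  unfolding det_def by (intro continuous_intros assms)

lemma continuous_on_cramer_num:
  fixes S :: "(real^'m^'m) set"
  shows "continuous_on S cramer_num"
proof -
  have "continuous_on S (\<lambda>A. if j = k then 1 else A $ i $ j)" for i j k :: 'm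
    by (cases "j = k") (auto intro!: continuous_intros)
  then show ?thesis
    unfolding cramer_num_def by (intro continuous_intros)
qed

lemma matrix_inv_one_cramer:
  assumes "det A \<noteq> 0"
  shows "matrix_inv A *v 1 = (1 / det A) *\<^sub>R cramer_num A"
proof -
  have "A *v (matrix_inv A *v 1) = 1" using assms by (rule matrix_inv_mult_vector)
  then show ?thesis
    unfolding cramer[OF assms] by (simp add: cramer_num_def vec_eq_iff cong: if_cong)
qed

text \<open>The determinant in Cramer's rule cancels in the normalization to total weight 1.\<close>
lemma opt_weights_cramer:
  assumes "det A \<noteq> 0"
  shows "opt_weights A = (1 / (1 \<bullet> cramer_num A)) *\<^sub>R cramer_num A"
  using assms by (simp add: opt_weights_def matrix_inv_one_cramer)

text \<open>
  On singular matrices \<^const>\<open>matrix_inv\<close> chooses a witness of a predicate that nothing satisfies, so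
  it does not depend on the matrix; the weights are glued from two measurable pieces.
\<close>
lemma borel_measurable_opt_weights: "(opt_weights :: real^'m^'m \<Rightarrow> real^'m) \<in> borel_measurable borel"
proof -
  define B :: "real^'m^'m" where "B = (SOME B. False)"
  define c where "c = (1 / (1 \<bullet> (B *v 1))) *\<^sub>R (B *v 1)"
  have singular: "opt_weights A = c" if "det A = 0" for A
  proof -
    have "\<not> invertible A" using that by (simp add: invertible_det_nz)
    then have "matrix_inv A = B"
      unfolding matrix_inv_def B_def by (intro arg_cong[where f = Eps] ext) (auto simp: invertible_def)
    then show ?thesis by (simp add: opt_weights_def c_def)
  qed
  have [measurable]: "det \<in> borel_measurable (borel :: (real^'m^'m) measure)"
    by (intro borel_measurable_continuous_onI continuous_intros)
  have [measurable]: "cramer_num \<in> borel_measurable (borel :: (real^'m^'m) measure)"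
    by (intro borel_measurable_continuous_onI continuous_on_cramer_num)
  have eq: "opt_weights = (\<lambda>A::real^'m^'m. if det A = 0 then c else (1 / (1 \<bullet> cramer_num A)) *\<^sub>R cramer_num A)"
    by (auto simp: fun_eq_iff singular opt_weights_cramer)
  show ?thesis unfolding eq by measurable
qed

lemma isCont_opt_weights:
  fixes A :: "real^'m^'m"
  assumes A: "positive_definite A"
  shows "isCont opt_weights A"
proof -
  have nz: "det A \<noteq> 0" using A by (rule positive_definite_imp_det_nonzero)
  have "1 \<bullet> cramer_num A \<noteq> 0"
    using positive_definite_imp_total_weight_pos[OF A] by (auto simp: matrix_inv_one_cramer[OF nz])
  moreover have "isCont cramer_num A"
    using continuous_on_cramer_num[of "UNIV :: (real^'m^'m) set"]
    by (simp add: continuous_on_eq_continuous_at)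
  ultimately have cont: "isCont (\<lambda>A. (1 / (1 \<bullet> cramer_num A)) *\<^sub>R cramer_num A) A"
    by (intro continuous_intros)
  have "open {B :: real^'m^'m. det B \<noteq> 0}"
    by (intro open_Collect_neq continuous_intros)
  then have "\<forall>\<^sub>F B in nhds A. det B \<noteq> 0"
    using nz eventually_nhds_in_open[of "{B. det B \<noteq> 0}" A] by simp
  then have "\<forall>\<^sub>F B in nhds A. opt_weights B = (1 / (1 \<bullet> cramer_num B)) *\<^sub>R cramer_num B"
    by (rule eventually_mono) (rule opt_weights_cramer)
  with cont show ?thesis by (simp add: isCont_cong)
qed

section \<open>The plug-in matrix\<close>

lemma H_mis_hat_at_SNR:
  fixes \<sigma> :: real
  assumes "\<sigma> \<noteq> 0"
  shows "H_mis_hat (r\<^sup>2 / \<sigma>\<^sup>2) (\<lambda>i. r\<^sup>2 * \<kappa> i / \<sigma>\<^sup>2) (\<lambda>i j. r\<^sup>2 * \<kappa>2 i j / \<sigma>\<^sup>2) \<eta> \<eta>2 \<gamma> \<gamma>2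
    = (1 / \<sigma>\<^sup>2) *\<^sub>R H_mis r \<sigma> \<kappa> \<kappa>2 \<eta> \<eta>2 \<gamma> \<gamma>2"
proof -
  define g where "g = r\<^sup>2 / \<sigma>\<^sup>2"
  have r: "r\<^sup>2 = g * \<sigma>\<^sup>2" using assms by (simp add: g_def)
  have "\<sigma>\<^sup>2 * H_mis_hat g (\<lambda>i. g * \<kappa> i) (\<lambda>i j. g * \<kappa>2 i j) \<eta> \<eta>2 \<gamma> \<gamma>2 $ i $ j
      = H_mis r \<sigma> \<kappa> \<kappa>2 \<eta> \<eta>2 \<gamma> \<gamma>2 $ i $ j" for i j
    unfolding H_mis_hat_def H_mis_def Let_def r
    by (simp add: divide_inverse algebra_simps)
  then have "H_mis_hat g (\<lambda>i. g * \<kappa> i) (\<lambda>i j. g * \<kappa>2 i j) \<eta> \<eta>2 \<gamma> \<gamma>2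
      = (1 / \<sigma>\<^sup>2) *\<^sub>R H_mis r \<sigma> \<kappa> \<kappa>2 \<eta> \<eta>2 \<gamma> \<gamma>2"
    using assms by (simp add: vec_eq_iff field_simps)
  then show ?thesis by (simp add: g_def)
qed

text \<open>
  All estimates are collected in one vector with real entries, indexed by the overall, per-model and
  pairwise ratios, so that convergence can be checked entry by entry.
\<close>
type_synonym 'm ratios = "real^(unit + 'm + 'm \<times> 'm)"

definition H_of_ratios ::
    "('m::finite \<Rightarrow> real) \<Rightarrow> ('m \<Rightarrow> 'm \<Rightarrow> real) \<Rightarrow> ('m \<Rightarrow> real) \<Rightarrow> ('m \<Rightarrow> 'm \<Rightarrow> real) \<Rightarrow>
     'm ratios \<Rightarrow> real^'m^'m" where
  "H_of_ratios \<eta> \<eta>2 \<gamma> \<gamma>2 \<theta> = H_mis_hat (\<theta> $ Inl ()) (\<lambda>i. \<theta> $ Inr (Inl i)) (\<lambda>i j. \<theta> $ Inr (Inr (i, j))) \<eta> \<eta>2 \<gamma> \<gamma>2"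

text \<open>
  A model has no pairwise ratio with itself. The constant 0 in the diagonal entries makes the whole
  vector converge as soon as the genuine estimators do.
\<close>
definition ratios :: "real \<Rightarrow> ('m::finite \<Rightarrow> real) \<Rightarrow> ('m \<Rightarrow> 'm \<Rightarrow> real) \<Rightarrow> 'm ratios" where
  "ratios \<Gamma> \<Gamma>1 \<Gamma>2 = (\<chi> s. case s of Inl _ \<Rightarrow> \<Gamma> | Inr (Inl i) \<Rightarrow> \<Gamma>1 i
     | Inr (Inr (i, j)) \<Rightarrow> if i = j then 0 else \<Gamma>2 i j)"

lemma H_of_ratios_ratios:
  "H_of_ratios \<eta> \<eta>2 \<gamma> \<gamma>2 (ratios \<Gamma> \<Gamma>1 \<Gamma>2) = H_mis_hat \<Gamma> \<Gamma>1 \<Gamma>2 \<eta> \<eta>2 \<gamma> \<gamma>2"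
  by (simp add: H_of_ratios_def H_mis_hat_def ratios_def vec_eq_iff Let_def)

text \<open>Each entry is affine in the ratios: which formula applies depends only on the fixed limits.\<close>
lemma continuous_on_H_of_ratios:
  fixes S :: "'m::finite ratios set"
  shows "continuous_on S (H_of_ratios \<eta> \<eta>2 \<gamma> \<gamma>2)"
proof -
  have if_const: "continuous_on S (\<lambda>\<theta>. if P then f \<theta> else g \<theta>)"
    if "continuous_on S f" "continuous_on S g" for P and f g :: "'m ratios \<Rightarrow> real"
    using that by (cases P) auto
  show ?thesis
    unfolding H_of_ratios_def H_mis_hat_def Let_def divide_inverse
    by (intro continuous_on_vec_lambda if_const continuous_on_add continuous_on_mult continuous_on_diff
        continuous_on_const continuous_on_component continuous_on_id)
qed

theorem corollary2p4:
  fixes M :: "nat \<Rightarrow> 'a measure"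
    and p :: "nat \<Rightarrow> nat"
    and X :: "nat \<Rightarrow> nat \<Rightarrow> nat \<Rightarrow> 'a \<Rightarrow> real"
    and \<epsilon> y :: "nat \<Rightarrow> nat \<Rightarrow> 'a \<Rightarrow> real"
    and \<beta> :: "nat \<Rightarrow> nat \<Rightarrow> real"
    and S T :: "'m::finite \<Rightarrow> nat \<Rightarrow> nat set"
    and r \<sigma> \<gamma>0 :: real
    and \<gamma> \<eta> \<kappa> :: "'m \<Rightarrow> real"
    and \<gamma>2 \<eta>2 \<kappa>2 :: "'m \<Rightarrow> 'm \<Rightarrow> real"
    and G :: "nat \<Rightarrow> (nat \<times> nat \<Rightarrow> real) \<times> (nat \<Rightarrow> real) \<Rightarrow> real"
    and G1 :: "'m \<Rightarrow> nat \<Rightarrow> (nat \<times> nat \<Rightarrow> real) \<times> (nat \<Rightarrow> real) \<Rightarrow> real"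
    and G2 :: "'m \<Rightarrow> 'm \<Rightarrow> nat \<Rightarrow> (nat \<times> nat \<Rightarrow> real) \<times> (nat \<Rightarrow> real) \<Rightarrow> real"
  assumes model: "\<And>n. linear_model (M n) n (p n) (X n) (\<beta> n) (\<epsilon> n) (y n) \<sigma>"
    and noise: "\<sigma>\<^sup>2 > 0"
    and X_iid: "\<And>n. iid_on (M n) ({..<n} \<times> {..<p n}) (\<lambda>(i, j). X n i j)"
    and X_mean_var: "\<And>n i j. i < n \<Longrightarrow> j < p n \<Longrightarrow> has_mean_var (M n) (X n i j) 0 1"
    and X_moment: "\<exists>\<delta>>0. \<forall>n. \<forall>i<n. \<forall>j<p n. integrable (M n) (\<lambda>\<omega>. \<bar>X n i j \<omega>\<bar> powr (12 + \<delta>))"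
    and p_infinity: "filterlim p at_top sequentially"
    and p_ratio: "(\<lambda>n. real (p n) / real n) \<longlonglongrightarrow> \<gamma>0" "\<gamma>0 > 0"
    and S_subset: "\<And>i n. S i n \<subseteq> {..<p n}"
    and S_infinity: "\<And>i. filterlim (\<lambda>n. card (S i n)) at_top sequentially"
    and S_ratio: "\<And>i. (\<lambda>n. real (card (S i n)) / real n) \<longlonglongrightarrow> \<gamma> i" "\<And>i. \<gamma> i > 0"
    and S2_infinity: "\<And>i j. i \<noteq> j \<Longrightarrow> filterlim (\<lambda>n. card (S i n \<inter> S j n)) at_top sequentially"
    and S2_ratio: "\<And>i j. i \<noteq> j \<Longrightarrow> (\<lambda>n. real (card (S i n \<inter> S j n)) / real n) \<longlonglongrightarrow> \<gamma>2 i j"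
      "\<And>i j. i \<noteq> j \<Longrightarrow> \<gamma>2 i j > 0"
    and T_subset: "\<And>i n. T i n \<subseteq> {..<n}"
    and T_infinity: "\<And>i. filterlim (\<lambda>n. card (T i n)) at_top sequentially"
    and T_ratio: "\<And>i. (\<lambda>n. real (card (T i n)) / real n) \<longlonglongrightarrow> \<eta> i" "\<And>i. \<eta> i > 0"
    and T2_ratio: "\<And>i j. i \<noteq> j \<Longrightarrow> (\<lambda>n. real (card (T i n \<inter> T j n)) / real n) \<longlonglongrightarrow> \<eta>2 i j"
      "\<And>i j. i \<noteq> j \<Longrightarrow> \<eta>2 i j > 0"
    and non_critical: "\<And>i. \<gamma> i \<noteq> \<eta> i"
    and signal: "r > 0" "\<And>n. sqnorm_on {..<p n} (\<beta> n) = r\<^sup>2"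
    and kappa: "\<And>i n. sqnorm_on (S i n) (\<beta> n) = r\<^sup>2 * \<kappa> i" "\<And>i. \<kappa> i \<in> {0<..<1}"
    and kappa2: "\<And>i j n. i \<noteq> j \<Longrightarrow> sqnorm_on (S i n \<inter> S j n) (\<beta> n) = r\<^sup>2 * \<kappa>2 i j"
      "\<And>i j. i \<noteq> j \<Longrightarrow> \<kappa>2 i j \<in> {0<..<1}"
    and H_pos_def: "positive_definite (H_mis r \<sigma> \<kappa> \<kappa>2 \<eta> \<eta>2 \<gamma> \<gamma>2)"
    and SNR: "consistent_estimator M p X y G (r\<^sup>2 / \<sigma>\<^sup>2)"
    and SNR1: "\<And>i. consistent_estimator M p X y (G1 i) (r\<^sup>2 * \<kappa> i / \<sigma>\<^sup>2)"
    and SNR2: "\<And>i j. i \<noteq> j \<Longrightarrow> consistent_estimator M p X y (G2 i j) (r\<^sup>2 * \<kappa>2 i j / \<sigma>\<^sup>2)"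
  shows "\<exists>w. argmin_weights (H_mis r \<sigma> \<kappa> \<kappa>2 \<eta> \<eta>2 \<gamma> \<gamma>2) = {w} \<and>
    tendsto_in_prob M
      (\<lambda>n \<omega>. opt_weights
        (H_mis_hat (estimate p X y G n \<omega>) (\<lambda>i. estimate p X y (G1 i) n \<omega>)
          (\<lambda>i j. estimate p X y (G2 i j) n \<omega>) \<eta> \<eta>2 \<gamma> \<gamma>2)) w"
proof -
  have M: "finite_measure (M n)" for n
    using model[of n] by (simp add: linear_model_def prob_space.finite_measure)
  define H where "H = H_mis r \<sigma> \<kappa> \<kappa>2 \<eta> \<eta>2 \<gamma> \<gamma>2"
  define est where "est = (\<lambda>n \<omega>. ratios (estimate p X y G n \<omega>) (\<lambda>i. estimate p X y (G1 i) n \<omega>)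
    (\<lambda>i j. estimate p X y (G2 i j) n \<omega>))"
  define \<theta> where "\<theta> = ratios (r\<^sup>2 / \<sigma>\<^sup>2) (\<lambda>i. r\<^sup>2 * \<kappa> i / \<sigma>\<^sup>2) (\<lambda>i j. r\<^sup>2 * \<kappa>2 i j / \<sigma>\<^sup>2)"
  define f where "f = (\<lambda>\<theta>. opt_weights (H_of_ratios \<eta> \<eta>2 \<gamma> \<gamma>2 \<theta>))"
  have H\<theta>: "H_of_ratios \<eta> \<eta>2 \<gamma> \<gamma>2 \<theta> = (1 / \<sigma>\<^sup>2) *\<^sub>R H"
    unfolding \<theta>_def H_of_ratios_ratios H_def using noise by (intro H_mis_hat_at_SNR) auto
  have pd: "positive_definite (H_of_ratios \<eta> \<eta>2 \<gamma> \<gamma>2 \<theta>)"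
    unfolding H\<theta> using noise H_pos_def by (intro positive_definite_scaleR) (auto simp: H_def)
  have "argmin_weights H = argmin_weights (H_of_ratios \<eta> \<eta>2 \<gamma> \<gamma>2 \<theta>)"
    unfolding H\<theta> using noise by (intro argmin_weights_scaleR[symmetric]) simp
  then have argmin: "argmin_weights H = {f \<theta>}"
    by (simp add: argmin_weights_pos_def[OF pd] f_def)
  have "tendsto_in_prob M est \<theta>"
  proof (rule tendsto_in_prob_vec[OF M])
    fix s :: "unit + 'm + 'm \<times> 'm"
    consider "s = Inl ()" | i where "s = Inr (Inl i)" | i j where "s = Inr (Inr (i, j))"
      by (metis obj_sumE surj_pair old.unit.exhaust)
    then show "tendsto_in_prob M (\<lambda>n \<omega>. est n \<omega> $ s) (\<theta> $ s)"
    proof cases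
      case 1
      then show ?thesis using SNR by (simp add: est_def \<theta>_def ratios_def consistent_estimator_def)
    next
      case (2 i)
      then show ?thesis using SNR1[of i] by (simp add: est_def \<theta>_def ratios_def consistent_estimator_def)
    next
      case (3 i j)
      then show ?thesis using SNR2[of i j]
        by (cases "i = j")
          (simp_all add: est_def \<theta>_def ratios_def consistent_estimator_def tendsto_in_prob_const)
    qed
  qed
  then have "tendsto_in_prob M (\<lambda>n \<omega>. f (est n \<omega>)) (f \<theta>)"
  proof (rule tendsto_in_prob_isCont[OF M])
    show "f \<in> borel_measurable borel"
      unfolding f_def
      by (rule measurable_compose[OF borel_measurable_continuous_onI borel_measurable_opt_weights])
        (rule continuous_on_H_of_ratios)
    have "isCont (H_of_ratios \<eta> \<eta>2 \<gamma> \<gamma>2) \<theta>"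
      using continuous_on_H_of_ratios[of UNIV \<eta> \<eta>2 \<gamma> \<gamma>2]
      by (simp add: continuous_on_eq_continuous_at)
    then show "isCont f \<theta>"
      unfolding f_def by (rule isCont_o2) (rule isCont_opt_weights[OF pd])
  qed
  then show ?thesis
    using argmin by (auto simp: f_def est_def H_of_ratios_ratios H_def)
qed

end
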